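(* There is no Neumaier graph whose adjacency matrix has exactly four distinct eigenvalues.
   Context: A graph is edge-regular if it is regular and any two adjacent vertices have the same number of common neighbours. A clique $C$ in a regular graph is a regular clique if every vertex outside $C$ is adjacent to the same positive number of vertices of $C$. A Neumaier graph is a non-complete edge-regular graph containing a regular clique. *)

theory Defs
  imports
    "Graph_Theory.Graph_Theory"
    "Jordan_Normal_Form.Spectral_Radius"
begin

text \<open>
  A finite simple undirected graph is a \<^locale>\<open>pair_graph\<close>: an edge is a pair of opposite arcs, so
  the degree of a vertex is its \<^const>\<open>out_degree\<close>.
\<close>

definition neighbours :: "'a pair_pre_digraph \<Rightarrow> 'a \<Rightarrow> 'a set" where
  "neighbours G v = {w. (v, w) \<in> parcs G}"

definition regular_graph :: "'a pair_pre_digraph \<Rightarrow> bool" where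
  "regular_graph G \<longleftrightarrow>
     pair_graph G \<and> (\<exists>k. \<forall>v \<in> pverts G. out_degree (with_proj G) v = k)"

definition edge_regular :: "'a pair_pre_digraph \<Rightarrow> bool" where
  "edge_regular G \<longleftrightarrow>
     regular_graph G \<and>
     (\<exists>l. \<forall>(u, v) \<in> parcs G. card (neighbours G u \<inter> neighbours G v) = l)"

definition clique :: "'a pair_pre_digraph \<Rightarrow> 'a set \<Rightarrow> bool" where
  "clique G C \<longleftrightarrow>
     C \<subseteq> pverts G \<and> (\<forall>u \<in> C. \<forall>v \<in> C. u \<noteq> v \<longrightarrow> (u, v) \<in> parcs G)"

definition regular_clique :: "'a pair_pre_digraph \<Rightarrow> 'a set \<Rightarrow> bool" where
  "regular_clique G C \<longleftrightarrow>
     regular_graph G \<and> clique G C \<and>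
     (\<exists>e > 0. \<forall>v \<in> pverts G - C. card (neighbours G v \<inter> C) = e)"

definition complete_graph :: "'a pair_pre_digraph \<Rightarrow> bool" where
  "complete_graph G \<longleftrightarrow> (\<exists>n. complete_digraph n (with_proj G))"

definition neumaier_graph :: "'a pair_pre_digraph \<Rightarrow> bool" where
  "neumaier_graph G \<longleftrightarrow>
     edge_regular G \<and> \<not> complete_graph G \<and> (\<exists>C. regular_clique G C)"

text \<open>
  The list \<open>vs\<close> is the ordering of the vertices by which rows and columns are indexed.
\<close>

definition adjacency_matrix :: "'a pair_pre_digraph \<Rightarrow> 'a list \<Rightarrow> 'b :: zero_neq_one mat" where
  "adjacency_matrix G vs =
     mat (length vs) (length vs) (\<lambda>(i, j). if (vs ! i, vs ! j) \<in> parcs G then 1 else 0)"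

end

theory Submission
  imports Defs "HOL-Library.Indicator_Function"
begin

text \<open>
  Let the graph have valency \<open>k\<close>, clique size \<open>s\<close> and nexus \<open>e\<close>. The indicator of the clique
  \<open>C\<close> lies in the span of the all-ones vector and an eigenvector for \<open>\<theta> = s - 1 - e\<close>. Suppose
  the eigenvalues are \<open>k, \<theta>, t, u\<close>. Since the adjacency matrix \<open>A\<close> is diagonalisable and \<open>k\<close> is
  simple, \<open>Q = (A - \<theta>) (A - u) - d J\<close> satisfies \<open>A Q = t Q\<close> for a suitable \<open>d\<close>. Being quadratic
  in \<open>A\<close>, \<open>Q\<close> takes a constant value \<open>q\<^sub>0\<close> on the diagonal and, by edge-regularity, a constant
  value \<open>q\<^sub>1\<close> on the edges. The diagonal of \<open>A Q = t Q\<close> gives \<open>k q\<^sub>1 = t q\<^sub>0\<close>, and \<open>Q 1\<^sub>C = 0\<close>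
  gives \<open>q\<^sub>0 + (s - 1) q\<^sub>1 = 0\<close>. If \<open>q\<^sub>1 = 0\<close> then \<open>tr Q = 0\<close>, so \<open>tr Q\<^sup>2 = 0\<close> as \<open>Q\<^sup>2\<close> is a multiple
  of \<open>Q\<close>, and \<open>Q = 0\<close>, which is absurd; hence \<open>t = - k / (s - 1)\<close>. By symmetry \<open>u\<close> has the same
  value.
\<close>

section \<open>Linear dependence and polynomials in the adjacency operator\<close>

text \<open>One function more than there are points forces a linear dependence. Its coefficients are
  packed into a polynomial so that, for \<open>g i\<close> the \<open>i\<close>-th iterate of an
  operator on a fixed function, it can be factored.\<close>

lemma linear_dependence_poly:
  fixes g :: "nat \<Rightarrow> 'a \<Rightarrow> 'b :: field"
  assumes "finite V"
  obtains p where "p \<noteq> 0" "degree p \<le> card V"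
    "\<And>x. x \<in> V \<Longrightarrow> (\<Sum>i\<le>card V. coeff p i * g i x) = 0"
proof -
  obtain xs where xs: "set xs = V" "distinct xs"
    using finite_distinct_list[OF assms] by blast
  define n where "n = card V"
  have len: "length xs = n"
    using xs by (auto simp: n_def distinct_card[symmetric])
  \<comment> \<open>a square matrix with a vanishing bottom row, hence singular\<close>
  define M where "M = mat (Suc n) (Suc n) (\<lambda>(i, j). if i < n then g j (xs ! i) else 0)"
  have M: "M \<in> carrier_mat (Suc n) (Suc n)"
    by (simp add: M_def)
  have "M = mat\<^sub>r (Suc n) (Suc n) (\<lambda>i. if i = n then 0\<^sub>v (Suc n) else row M i)"
    by (rule eq_matI) (auto simp: M_def)
  moreover have "det \<dots> = 0"
    using M by (intro det_row_0) auto
  ultimately have "det M = 0"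
    by simp
  then obtain c where c: "c \<in> carrier_vec (Suc n)" "c \<noteq> 0\<^sub>v (Suc n)" "M *\<^sub>v c = 0\<^sub>v (Suc n)"
    using det_0_iff_vec_prod_zero_field[OF M] by blast
  define p where "p = Poly (list_of_vec c)"
  have coeff: "coeff p i = c $ i" if "i \<le> n" for i
    using that c(1) by (auto simp: p_def nth_default_def list_of_vec_index)
  show thesis
  proof
    from c obtain i where "i < Suc n" "c $ i \<noteq> 0"
      by (metis carrier_vecD eq_vecI index_zero_vec)
    then show "p \<noteq> 0"
      using coeff[of i] by auto
    show "degree p \<le> card V"
      unfolding n_def[symmetric] using c(1)
      by (intro degree_le) (auto simp: p_def nth_default_def)
    fix x assume "x \<in> V"
    then obtain i where i: "i < n" "x = xs ! i"
      using xs(1) len by (metis in_set_conv_nth)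
    have "0 = (M *\<^sub>v c) $ i"
      using c(3) i by simp
    also have "\<dots> = (\<Sum>j\<le>n. g j x * c $ j)"
      using i c(1) by (simp add: M_def scalar_prod_def lessThan_Suc_atMost[symmetric] atLeast0LessThan)
    also have "\<dots> = (\<Sum>j\<le>n. coeff p j * g j x)"
      by (intro sum.cong) (auto simp: coeff)
    finally show "(\<Sum>i\<le>card V. coeff p i * g i x) = 0"
      by (simp add: n_def)
  qed
qed

text \<open>
  The operator \<open>A - t I\<close> on functions on the vertices, so that products of such operators become
  \<open>foldr (shift G) ts\<close>.
\<close>

definition shift :: "'a pair_pre_digraph \<Rightarrow> 'b :: comm_ring_1 \<Rightarrow> ('a \<Rightarrow> 'b) \<Rightarrow> 'a \<Rightarrow> 'b" where
  "shift G t f x = (\<Sum>y\<in>neighbours G x. f y) - t * f x"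

lemma shift_commute: "shift G s (shift G t f) = shift G t (shift G s f)"
  by (auto simp: shift_def fun_eq_iff sum_subtractf sum_distrib_left[symmetric] algebra_simps)

lemma shift_foldr: "shift G s (foldr (shift G) ts f) = foldr (shift G) ts (shift G s f)"
proof (induction ts)
  case (Cons t ts)
  show ?case
    by (simp add: shift_commute[of G s] Cons)
qed simp

lemma foldr_shift_remove1:
  assumes "s \<in> set ts"
  shows "foldr (shift G) ts f = shift G s (foldr (shift G) (remove1 s ts) f)"
  using assms by (induction ts) (auto simp: shift_commute[of G _ s])

text \<open>\<open>shift G 0\<close> is \<open>A\<close> itself, so the right-hand side evaluates
  the monic polynomial with root list \<open>ts\<close> at \<open>A\<close>. This turns a factorised
  polynomial into a product of shifts.\<close>

lemma foldr_shift_poly: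
  fixes f :: "'a \<Rightarrow> 'b :: comm_ring_1"
  shows "foldr (shift G) ts f x =
    (\<Sum>i\<le>length ts. coeff (\<Prod>t\<leftarrow>ts. [:-t, 1:]) i * (shift G 0 ^^ i) f x)"
proof (induction ts arbitrary: x)
  case (Cons t ts)
  define p where "p = (\<Prod>t\<leftarrow>ts. [:-t, 1:])"
  define m where "m = length ts"
  have "degree p \<le> m"
    unfolding p_def m_def
  proof (induction ts)
    case (Cons t ts)
    then show ?case
      using degree_mult_le[of "[:-t, 1:]" "\<Prod>t\<leftarrow>ts. [:-t, 1:]"] by (simp del: mult_pCons_left)
  qed simp
  \<comment> \<open>Allows the sum for \<open>p\<close> to be extended to \<open>Suc m\<close>, the
    range needed once multiplication by the variable has moved the coefficients up by one.\<close>
  then have top: "coeff p (Suc m) = 0"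
    by (simp add: coeff_eq_0)
  have IH: "foldr (shift G) ts f = (\<lambda>x. \<Sum>i\<le>m. coeff p i * (shift G 0 ^^ i) f x)"
    using Cons by (auto simp: p_def m_def)
  have "foldr (shift G) (t # ts) f x =
      (\<Sum>i\<le>m. coeff p i * (shift G 0 ^^ Suc i) f x) - t * (\<Sum>i\<le>m. coeff p i * (shift G 0 ^^ i) f x)"
    unfolding foldr.simps o_def IH
    by (subst shift_def, subst sum.swap) (simp add: sum_distrib_left shift_def)
  also have "(\<Sum>i\<le>m. coeff p i * (shift G 0 ^^ Suc i) f x) =
      (\<Sum>i\<le>Suc m. coeff (pCons 0 p) i * (shift G 0 ^^ i) f x)"
    by (subst sum.atMost_Suc_shift) simp
  also have "(\<Sum>i\<le>m. coeff p i * (shift G 0 ^^ i) f x) =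
      (\<Sum>i\<le>Suc m. coeff p i * (shift G 0 ^^ i) f x)"
    by (simp add: top)
  also have "(\<Sum>i\<le>Suc m. coeff (pCons 0 p) i * (shift G 0 ^^ i) f x) - t * \<dots> =
      (\<Sum>i\<le>Suc m. coeff ([:-t, 1:] * p) i * (shift G 0 ^^ i) f x)"
    unfolding sum_distrib_left sum_subtractf[symmetric]
    by (intro sum.cong refl) (simp add: algebra_simps)
  finally show ?case
    by (simp add: p_def m_def)
qed simp

section \<open>Symmetry of the adjacency operator\<close>

context pair_graph
begin

lemma neighbours_subset: "neighbours G x \<subseteq> pverts G"
  by (auto simp: neighbours_def dest: in_arcsD2)

lemma not_neighbour_self [simp]: "x \<notin> neighbours G x"
  using pair_no_loops by (force simp: neighbours_def)

lemma finite_neighbours [simp]: "finite (neighbours G x)"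
  using neighbours_subset finite_subset pair_finite_verts by blast

lemma neighbours_sym: "y \<in> neighbours G x \<longleftrightarrow> x \<in> neighbours G y"
  using arcs_symmetric by (auto simp: neighbours_def)

lemma out_degree_eq_card_neighbours: "out_degree G x = card (neighbours G x)"
proof -
  have "bij_betw snd (out_arcs G x) (neighbours G x)"
    by (rule bij_betw_byWitness[where f' = "\<lambda>y. (x, y)"]) (auto simp: neighbours_def)
  then show ?thesis
    by (simp add: out_degree_def bij_betw_same_card)
qed

lemma shift_cong:
  assumes "\<And>x. x \<in> pverts G \<Longrightarrow> f x = g x" "x \<in> pverts G"
  shows "shift G t f x = shift G t g x"
  using assms neighbours_subset[of x] by (auto simp: shift_def intro!: sum.cong)

text \<open>Both sides run over all arcs, and reversing arcs permutes them.\<close>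

lemma sum_neighbours_swap:
  fixes h :: "'a \<Rightarrow> 'a \<Rightarrow> 'b :: comm_monoid_add"
  shows "(\<Sum>x\<in>pverts G. \<Sum>y\<in>neighbours G x. h x y) = (\<Sum>x\<in>pverts G. \<Sum>y\<in>neighbours G x. h y x)"
proof -
  have eq: "(\<Sum>x\<in>pverts G. \<Sum>y\<in>neighbours G x. h x y) =
      (\<Sum>x\<in>pverts G. \<Sum>y\<in>{y \<in> pverts G. y \<in> neighbours G x}. h x y)" for h :: "'a \<Rightarrow> 'a \<Rightarrow> 'b"
    by (intro sum.cong) (use neighbours_subset in auto)
  show ?thesis
    unfolding eq by (subst sum.swap_restrict) (simp_all add: neighbours_sym)
qed

text \<open>The form is bilinear, without conjugation, so that it makes sense over any commutative
  ring; over the complex numbers \<open>cnj\<close> is inserted by hand.\<close>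

lemma shift_self_adjoint:
  "(\<Sum>x\<in>pverts G. g x * shift G t f x) = (\<Sum>x\<in>pverts G. shift G t g x * f x)"
proof -
  have "(\<Sum>x\<in>pverts G. \<Sum>y\<in>neighbours G x. g x * f y) =
      (\<Sum>x\<in>pverts G. \<Sum>y\<in>neighbours G x. g y * f x)"
    by (rule sum_neighbours_swap)
  then show ?thesis
    by (simp add: shift_def algebra_simps sum_subtractf sum_distrib_left sum_distrib_right)
qed

section \<open>Real eigenvalues and diagonalisability\<close>

text \<open>Functions live on the whole type, so both the eigenvalue equation and being nonzero are
  tested on the vertices only.\<close>

definition eigenvalue_on :: "'b :: comm_ring_1 \<Rightarrow> bool" where
  "eigenvalue_on t \<longleftrightarrow> (\<exists>f. (\<exists>x\<in>pverts G. f x \<noteq> 0) \<and> (\<forall>x\<in>pverts G. shift G t f x = 0))"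

lemma sum_cnj_mult_eq_0:
  fixes f :: "'a \<Rightarrow> complex"
  assumes "(\<Sum>x\<in>pverts G. cnj (f x) * f x) = 0" "x \<in> pverts G"
  shows "f x = 0"
proof -
  have "(\<Sum>x\<in>pverts G. (cmod (f x))\<^sup>2) = 0"
    using assms(1) unfolding complex_norm_square of_real_eq_0_iff[where 'a = complex, symmetric] of_real_sum
    by (simp add: mult.commute)
  then show ?thesis
    using assms(2) by (subst (asm) sum_nonneg_eq_0_iff) auto
qed

lemma cnj_shift: "cnj (shift G t f x) = shift G (cnj t) (\<lambda>y. cnj (f y)) x"
  by (simp add: shift_def)

text \<open>The Hermitian argument: moving \<open>A - t\<close> from an eigenfunction
  \<open>f\<close> to its conjugate gives \<open>cnj t - t\<close> times the squared norm of
  \<open>f\<close>, and this must vanish.\<close>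

lemma eigenvalue_on_real:
  fixes t :: complex
  assumes "eigenvalue_on t"
  shows "t \<in> \<real>"
proof -
  obtain f where f: "\<exists>x\<in>pverts G. f x \<noteq> 0" "\<And>x. x \<in> pverts G \<Longrightarrow> shift G t f x = 0"
    using assms by (auto simp: eigenvalue_on_def)
  have "0 = (\<Sum>x\<in>pverts G. shift G t (\<lambda>y. cnj (f y)) x * f x)"
    using shift_self_adjoint[of "\<lambda>y. cnj (f y)" t f] f(2) by simp
  also have "\<dots> = (\<Sum>x\<in>pverts G. (cnj t - t) * (cnj (f x) * f x))"
  proof (intro sum.cong refl)
    fix x assume "x \<in> pverts G"
    then have "shift G (cnj t) (\<lambda>y. cnj (f y)) x = 0"
      using f(2) cnj_shift[of t f x] by simp
    then show "shift G t (\<lambda>y. cnj (f y)) x * f x = (cnj t - t) * (cnj (f x) * f x)"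
      by (simp add: shift_def algebra_simps)
  qed
  also have "\<dots> = (cnj t - t) * (\<Sum>x\<in>pverts G. cnj (f x) * f x)"
    by (rule sum_distrib_left[symmetric])
  finally have "cnj t - t = 0 \<or> (\<Sum>x\<in>pverts G. cnj (f x) * f x) = 0"
    by simp
  then have "cnj t = t"
    using f(1) sum_cnj_mult_eq_0[of f] by (metis right_minus_eq)
  then show ?thesis
    by (simp add: Reals_cnj_iff)
qed

text \<open>For real \<open>t\<close> the squared norm of \<open>(A - t) f\<close> is the Hermitian
  product of \<open>f\<close> with \<open>(A - t)\<^sup>2 f\<close>. Hence \<open>A\<close> has no
  nontrivial Jordan blocks.\<close>

lemma shift_shift_eq_0:
  fixes f :: "'a \<Rightarrow> complex"
  assumes "t \<in> \<real>" "\<And>x. x \<in> pverts G \<Longrightarrow> shift G t (shift G t f) x = 0" "x \<in> pverts G"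
  shows "shift G t f x = 0"
proof -
  have "(\<Sum>x\<in>pverts G. cnj (shift G t f x) * shift G t f x) =
      (\<Sum>x\<in>pverts G. cnj (f x) * shift G t (shift G t f) x)"
    unfolding shift_self_adjoint cnj_shift using assms(1) by (simp add: Reals_cnj_iff)
  then show ?thesis
    using assms by (intro sum_cnj_mult_eq_0[of "shift G t f"]) simp_all
qed

text \<open>The iterates of \<open>A\<close> on \<open>f\<close> are linearly dependent, and the
  resulting polynomial splits over the complex numbers. The list depends on \<open>f\<close>, and
  its entries may fail to be eigenvalues.\<close>

lemma foldr_shift_annihilates:
  fixes f :: "'a \<Rightarrow> complex"
  obtains ts where "\<And>x. x \<in> pverts G \<Longrightarrow> foldr (shift G) ts f x = 0"
proof -
  obtain p where p: "p \<noteq> 0" "degree p \<le> card (pverts G)"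
    "\<And>x. x \<in> pverts G \<Longrightarrow> (\<Sum>i\<le>card (pverts G). coeff p i * (shift G 0 ^^ i) f x) = 0"
    using linear_dependence_poly[OF pair_finite_verts, of "\<lambda>i. (shift G 0 ^^ i) f"] by blast
  obtain ts where ts: "Polynomial.smult (lead_coeff p) (\<Prod>t\<leftarrow>ts. [:-t, 1:]) = p" "length ts = degree p"
    using fundamental_theorem_algebra_factorized by blast
  have "foldr (shift G) ts f x = 0" if "x \<in> pverts G" for x
  proof -
    have "lead_coeff p * foldr (shift G) ts f x =
        (\<Sum>i\<le>degree p. coeff (Polynomial.smult (lead_coeff p) (\<Prod>t\<leftarrow>ts. [:-t, 1:])) i * (shift G 0 ^^ i) f x)"
      by (simp add: foldr_shift_poly ts(2) sum_distrib_left mult.assoc)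
    also have "\<dots> = (\<Sum>i\<le>card (pverts G). coeff p i * (shift G 0 ^^ i) f x)"
      unfolding ts(1) using p(2) by (intro sum.mono_neutral_left) (auto simp: coeff_eq_0)
    finally show ?thesis
      using p that by simp
  qed
  then show thesis
    using that by blast
qed

text \<open>Diagonalisability in polynomial form: a product with one factor for each eigenvalue
  already annihilates every function.\<close>

lemma foldr_shift_eq_0_complex:
  fixes f :: "'a \<Rightarrow> complex"
  assumes ts: "\<And>t. eigenvalue_on t \<Longrightarrow> t \<in> set ts" and x: "x \<in> pverts G"
  shows "foldr (shift G) ts f x = 0"
proof -
  \<comment> \<open>no \<open>A - s\<close> has a kernel on the range of the product: otherwise \<open>s\<close> is an eigenvalue, \<open>A - s\<close>
    is a factor of the product, and kernels of \<open>A - s\<close> and \<open>(A - s)\<^sup>2\<close> agree\<close>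
  have inj: "\<forall>x\<in>pverts G. foldr (shift G) ts u x = 0"
    if 0: "\<And>x. x \<in> pverts G \<Longrightarrow> shift G s (foldr (shift G) ts u) x = 0" for s and u :: "'a \<Rightarrow> complex"
  proof (cases "eigenvalue_on s")
    case True
    note eq = foldr_shift_remove1[OF ts[OF True], of G u]
    show ?thesis
      using 0 shift_shift_eq_0[OF eigenvalue_on_real[OF True]] unfolding eq by blast
  next
    case False
    then show ?thesis
      using 0 by (auto simp: eigenvalue_on_def)
  qed
  have "\<forall>x\<in>pverts G. foldr (shift G) ts u x = 0"
    if "\<forall>x\<in>pverts G. foldr (shift G) ss (foldr (shift G) ts u) x = 0" for ss and u :: "'a \<Rightarrow> complex"
    using that
  proof (induction ss arbitrary: u)
    \<comment> \<open>The factor for \<open>s\<close> is moved into the argument, the induction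
      hypothesis at \<open>shift G s u\<close> strips the factors in \<open>ss\<close>, and
      \<open>inj\<close> then strips \<open>s\<close>.\<close>
    case (Cons s ss)
    then have "\<forall>x\<in>pverts G. foldr (shift G) ts (shift G s u) x = 0"
      by (intro Cons.IH) (simp add: shift_foldr)
    then show ?case
      by (intro inj[of s]) (simp add: shift_foldr)
  qed simp
  moreover obtain ss where "\<And>x. x \<in> pverts G \<Longrightarrow> foldr (shift G) ss (foldr (shift G) ts f) x = 0"
    using foldr_shift_annihilates by blast
  ultimately show ?thesis
    using x by blast
qed

lemma foldr_shift_eq_0:
  fixes f :: "'a \<Rightarrow> real"
  assumes "\<And>t :: complex. eigenvalue_on t \<Longrightarrow> t \<in> of_real ` set ts" and "x \<in> pverts G"
  shows "foldr (shift G) ts f x = 0"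
proof -
  have "foldr (shift G) (map of_real ts) (\<lambda>x. complex_of_real (f x)) x = of_real (foldr (shift G) ts f x)" for x
    by (induction ts arbitrary: x) (simp_all add: shift_def)
  then show ?thesis
    using foldr_shift_eq_0_complex[of "map of_real ts" x "\<lambda>x. of_real (f x)"] assms by simp
qed

text \<open>\<open>A\<close> has real entries, so the real and imaginary parts of a complex
  eigenfunction satisfy the same equation, and one of them is nonzero.\<close>

lemma eigenvalue_on_of_real:
  "eigenvalue_on (complex_of_real t) \<longleftrightarrow> eigenvalue_on t"
proof
  assume "eigenvalue_on (complex_of_real t)"
  then obtain f where ex: "\<exists>x\<in>pverts G. f x \<noteq> 0" and f: "\<And>x. x \<in> pverts G \<Longrightarrow> shift G (complex_of_real t) f x = 0"
    by (auto simp: eigenvalue_on_def)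
  from ex obtain z where z: "z \<in> pverts G" "f z \<noteq> 0"
    by blast
  have Re: "shift G t (\<lambda>y. Re (f y)) x = Re (shift G (complex_of_real t) f x)"
    and Im: "shift G t (\<lambda>y. Im (f y)) x = Im (shift G (complex_of_real t) f x)" for x
    by (simp_all add: shift_def)
  have "\<forall>x\<in>pverts G. shift G t (\<lambda>y. Re (f y)) x = 0" "\<forall>x\<in>pverts G. shift G t (\<lambda>y. Im (f y)) x = 0"
    using f by (simp_all add: Re Im)
  moreover have "(\<exists>x\<in>pverts G. Re (f x) \<noteq> 0) \<or> (\<exists>x\<in>pverts G. Im (f x) \<noteq> 0)"
    using z by (auto simp: complex_eq_iff)
  ultimately show "eigenvalue_on t"
    unfolding eigenvalue_on_def
    by (elim disjE) (rule exI[of _ "\<lambda>x. Re (f x)"] exI[of _ "\<lambda>x. Im (f x)"], simp)+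
next
  assume "eigenvalue_on t"
  then obtain f where f: "\<exists>x\<in>pverts G. f x \<noteq> 0" "\<And>x. x \<in> pverts G \<Longrightarrow> shift G t f x = 0"
    by (auto simp: eigenvalue_on_def)
  have "shift G (complex_of_real t) (\<lambda>y. of_real (f y)) x = complex_of_real (shift G t f x)" for x
    by (simp add: shift_def)
  with f show "eigenvalue_on (complex_of_real t)"
    unfolding eigenvalue_on_def by (intro exI[of _ "\<lambda>y. of_real (f y)"]) auto
qed

section \<open>Matrix eigenvalues as eigenvalues of the operator\<close>

lemma eigenvalue_adjacency_matrix:
  fixes t :: "'b :: field"
  assumes "distinct vs" "set vs = pverts G"
  shows "eigenvalue (adjacency_matrix G vs) t \<longleftrightarrow> eigenvalue_on t"
proof -
  define n where "n = length vs"
  have row: "(adjacency_matrix G vs *\<^sub>v v) $ i - t * v $ i = shift G t f (vs ! i)"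
    if "v \<in> carrier_vec n" "i < n" and vf: "\<And>j. j < n \<Longrightarrow> v $ j = f (vs ! j)" for v i f
  proof -
    have "(adjacency_matrix G vs *\<^sub>v v) $ i =
        (\<Sum>j<n. (if vs ! j \<in> neighbours G (vs ! i) then 1 else 0) * f (vs ! j))"
      using that by (simp add: adjacency_matrix_def n_def scalar_prod_def neighbours_def atLeast0LessThan)
    also have "\<dots> = (\<Sum>y\<in>pverts G. (if y \<in> neighbours G (vs ! i) then 1 else 0) * f y)"
      using assms by (intro sum.reindex_bij_betw bij_betw_nth) (auto simp: n_def)
    also have "\<dots> = (\<Sum>y\<in>neighbours G (vs ! i). f y)"
      using neighbours_subset by (intro sum.mono_neutral_cong_right) auto
    finally show ?thesis
      using that by (simp add: shift_def)
  qed
  show ?thesis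
  proof
    assume "eigenvalue (adjacency_matrix G vs) t"
    then obtain v where v: "v \<in> carrier_vec n" "v \<noteq> 0\<^sub>v n" "adjacency_matrix G vs *\<^sub>v v = t \<cdot>\<^sub>v v"
      by (auto simp: eigenvalue_def eigenvector_def adjacency_matrix_def n_def)
    \<comment> \<open>The position of a vertex in \<open>vs\<close> is unique by distinctness; off
      the vertices \<open>f\<close> is unspecified, and \<open>eigenvalue_on\<close> does not look
      there.\<close>
    define f where "f x = v $ (THE i. i < n \<and> vs ! i = x)" for x
    have f: "v $ i = f (vs ! i)" if "i < n" for i
      unfolding f_def using that assms(1)
      by (intro arg_cong[where f = "\<lambda>i. v $ i"] the_equality[symmetric]) (auto simp: n_def nth_eq_iff_index_eq)
    obtain i where i: "i < n" "v $ i \<noteq> 0"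
      using v by (metis carrier_vecD eq_vecI index_zero_vec)
    show "eigenvalue_on t"
      unfolding eigenvalue_on_def
    proof (intro exI[of _ f] conjI ballI)
      show "\<exists>x\<in>pverts G. f x \<noteq> 0"
        using i f assms(2) n_def by (metis nth_mem)
      fix x assume "x \<in> pverts G"
      then obtain j where j: "j < n" "x = vs ! j"
        using assms(2) n_def by (metis in_set_conv_nth)
      then show "shift G t f x = 0"
        using row[OF v(1) j(1) f] v by simp
    qed
  next
    assume "eigenvalue_on t"
    then obtain f where f: "\<exists>x\<in>pverts G. f x \<noteq> 0" "\<And>x. x \<in> pverts G \<Longrightarrow> shift G t f x = 0"
      by (auto simp: eigenvalue_on_def)
    define v where "v = vec n (\<lambda>i. f (vs ! i))"
    have v: "v \<in> carrier_vec n" "\<And>j. j < n \<Longrightarrow> v $ j = f (vs ! j)"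
      by (auto simp: v_def)
    obtain i where "i < n" "f (vs ! i) \<noteq> 0"
      using f(1) assms(2) n_def by (metis in_set_conv_nth)
    then have "v \<noteq> 0\<^sub>v n"
      using v(2) by auto
    moreover have "adjacency_matrix G vs *\<^sub>v v = t \<cdot>\<^sub>v v"
    proof (rule eq_vecI)
      fix i assume "i < dim_vec (t \<cdot>\<^sub>v v)"
      then have "i < n"
        using v(1) by simp
      then have "vs ! i \<in> pverts G"
        using assms(2) nth_mem[of i vs] n_def by simp
      then show "(adjacency_matrix G vs *\<^sub>v v) $ i = (t \<cdot>\<^sub>v v) $ i"
        using row[OF v(1) \<open>i < n\<close> v(2)] f(2)[of "vs ! i"] \<open>i < n\<close> v(1) by simp
    qed (use v(1) in \<open>simp add: adjacency_matrix_def n_def\<close>)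
    ultimately show "eigenvalue (adjacency_matrix G vs) t"
      unfolding eigenvalue_def eigenvector_def using v(1)
      by (auto simp: adjacency_matrix_def n_def)
  qed
qed

end

section \<open>Neumaier graphs and the eigenvalues \<open>k\<close> and \<open>theta\<close>\<close>

text \<open>The parameters hidden by existential quantifiers in the definitions are fixed here;
  non-completeness enters through \<open>outside\<close>.\<close>

locale neumaier = pair_graph +
  fixes C :: "'a set" and k l e :: nat
  assumes regular: "x \<in> pverts G \<Longrightarrow> card (neighbours G x) = k"
    and edge_regular: "y \<in> neighbours G x \<Longrightarrow> card (neighbours G x \<inter> neighbours G y) = l"
    and clique: "clique G C"
    and outside: "\<exists>x. x \<in> pverts G - C"
    and nexus_pos: "e > 0"
    and nexus: "x \<in> pverts G - C \<Longrightarrow> card (neighbours G x \<inter> C) = e"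
begin

abbreviation "n \<equiv> real (card (pverts G))"
abbreviation "s \<equiv> real (card C)"

text \<open>Besides \<open>k\<close>, the other eigenvalue of the quotient matrix of the partition
  into \<open>C\<close> and its complement.\<close>

definition theta :: real where
  "theta = s - 1 - real e"

lemma C_subset: "C \<subseteq> pverts G"
  using clique by (auto simp: clique_def)

lemma finite_C [simp]: "finite C"
  using C_subset finite_subset pair_finite_verts by blast

lemma n_pos: "n > 0"
  using outside by (auto simp: card_gt_0_iff)

lemma C_nonempty: "\<exists>y. y \<in> C"
proof -
  obtain x where "x \<in> pverts G - C"
    using outside by blast
  then show ?thesis
    using nexus nexus_pos by (metis Int_empty_right all_not_in_conv card.empty less_irrefl)
qed

lemma k_pos: "k > 0"
proof -
  obtain x where x: "x \<in> pverts G - C"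
    using outside by blast
  then show ?thesis
    using nexus[OF x] nexus_pos regular[of x] card_mono[of "neighbours G x" "neighbours G x \<inter> C"] by simp
qed

lemma neighbours_clique: "x \<in> C \<Longrightarrow> neighbours G x \<inter> C = C - {x}"
  using clique not_neighbour_self[of x] by (auto simp: clique_def neighbours_def)

lemma card_clique_Diff: "x \<in> C \<Longrightarrow> real (card (C - {x})) = s - 1"
  by (metis One_nat_def Suc_leI card_Diff_singleton card_gt_0_iff empty_iff finite_C of_nat_1 of_nat_diff)

text \<open>A vertex has \<open>s - 1\<close> neighbours in \<open>C\<close> if it lies in
  \<open>C\<close>, and \<open>e\<close> otherwise. Since \<open>theta\<close> is the difference,
  subtracting \<open>theta\<close> on \<open>C\<close> levels the two counts.\<close>

lemma shift_clique:
  assumes "x \<in> pverts G"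
  shows "shift G theta (indicator C) x = real e"
proof -
  have sum: "(\<Sum>y\<in>neighbours G x. indicator C y) = real (card (neighbours G x \<inter> C))"
    by (simp add: indicator_def sum.If_cases Int_def)
  show ?thesis
  proof (cases "x \<in> C")
    case True
    then show ?thesis
      unfolding shift_def sum neighbours_clique[OF True] card_clique_Diff[OF True] by (simp add: theta_def)
  next
    case False
    then show ?thesis
      unfolding shift_def sum using assms nexus by simp
  qed
qed

lemma shift_const: "x \<in> pverts G \<Longrightarrow> shift G t (\<lambda>_. c) x = (real k - t) * c"
  using regular by (simp add: shift_def algebra_simps)

lemma sum_shift: "(\<Sum>x\<in>pverts G. shift G t f x) = (real k - t) * (\<Sum>x\<in>pverts G. f x)"
  using shift_self_adjoint[of "\<lambda>_. 1" t f] by (simp add: shift_const sum_distrib_left)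

text \<open>This is \<open>shift_clique\<close> summed over all vertices.\<close>

lemma theta_eq: "(real k - theta) * s = real e * n"
proof -
  have "(\<Sum>x\<in>pverts G. indicator C x) = s"
    using C_subset by (simp add: indicator_def sum.If_cases Int_absorb1)
  then show ?thesis
    using sum_shift[of theta "indicator C"] by (simp add: shift_clique mult.commute)
qed

lemma theta_neq: "real k \<noteq> theta"
  using theta_eq n_pos nexus_pos by auto

lemma eigenvalue_on_k: "eigenvalue_on (real k)"
  unfolding eigenvalue_on_def using outside by (intro exI[of _ "\<lambda>_. 1"]) (auto simp: shift_const)

lemma eigenvalue_on_theta: "eigenvalue_on theta"
proof -
  \<comment> \<open>Chosen so that \<open>A - theta\<close> also sends the constant \<open>c\<close>
    to \<open>e\<close>, which cancels the value in \<open>shift_clique\<close>.\<close>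
  define c where "c = real e / (real k - theta)"
  obtain x y where xy: "x \<in> C" "y \<in> pverts G" "y \<notin> C"
    using C_nonempty outside by blast
  have "shift G theta (\<lambda>x. indicator C x - c) z = 0" if "z \<in> pverts G" for z
  proof -
    have "shift G theta (\<lambda>x. indicator C x - c) z = shift G theta (indicator C) z - shift G theta (\<lambda>_. c) z"
      by (simp add: shift_def sum_subtractf algebra_simps)
    then show ?thesis
      using that theta_neq by (simp add: shift_clique shift_const c_def)
  qed
  moreover have "\<exists>z\<in>pverts G. indicator C z - c \<noteq> 0"
  proof (cases "c = 0")
    case True
    then show ?thesis using xy C_subset by (auto intro!: bexI[of _ x])
  next
    case False
    then show ?thesis using xy by (auto intro!: bexI[of _ y])
  qed
  ultimately show ?thesis
    unfolding eigenvalue_on_def by (intro exI[of _ "\<lambda>x. indicator C x - c"]) auto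
qed

text \<open>Simplicity of \<open>k\<close>: the Laplacian quadratic form of \<open>f\<close>
  vanishes, so \<open>f\<close> is constant along edges. The graph is connected through
  \<open>C\<close>, as every vertex outside has a neighbour in the clique.\<close>

lemma shift_k_eq_0_imp_const:
  assumes "\<And>x. x \<in> pverts G \<Longrightarrow> shift G (real k) f x = 0"
  obtains c where "\<And>x. x \<in> pverts G \<Longrightarrow> f x = c"
proof -
  have eq: "(\<Sum>y\<in>neighbours G x. f y) = real k * f x" if "x \<in> pverts G" for x
    using assms[OF that] by (simp add: shift_def)
  have "(\<Sum>x\<in>pverts G. \<Sum>y\<in>neighbours G x. (f x - f y)\<^sup>2) =
      (\<Sum>x\<in>pverts G. \<Sum>y\<in>neighbours G x. (f x)\<^sup>2) + (\<Sum>x\<in>pverts G. \<Sum>y\<in>neighbours G x. (f y)\<^sup>2)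
      - 2 * (\<Sum>x\<in>pverts G. \<Sum>y\<in>neighbours G x. f x * f y)"
    by (simp add: power2_diff sum.distrib sum_subtractf sum_distrib_left mult.assoc)
  also have "(\<Sum>x\<in>pverts G. \<Sum>y\<in>neighbours G x. (f y)\<^sup>2) = (\<Sum>x\<in>pverts G. \<Sum>y\<in>neighbours G x. (f x)\<^sup>2)"
    by (rule sum_neighbours_swap)
  also have "(\<Sum>x\<in>pverts G. \<Sum>y\<in>neighbours G x. f x * f y) = (\<Sum>x\<in>pverts G. \<Sum>y\<in>neighbours G x. (f x)\<^sup>2)"
    by (rule sum.cong[OF refl]) (simp add: sum_distrib_left[symmetric] eq regular power2_eq_square)
  finally have 0: "(\<Sum>x\<in>pverts G. \<Sum>y\<in>neighbours G x. (f x - f y)\<^sup>2) = 0"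
    by simp
  have adj: "f x = f y" if "x \<in> pverts G" "y \<in> neighbours G x" for x y
  proof -
    have "(\<Sum>y\<in>neighbours G x. (f x - f y)\<^sup>2) = 0"
      using 0 that by (subst (asm) sum_nonneg_eq_0_iff) (auto intro: sum_nonneg)
    then show ?thesis
      using that by (subst (asm) sum_nonneg_eq_0_iff) auto
  qed
  obtain y where y: "y \<in> C"
    using C_nonempty by blast
  have const_C: "f x = f y" if "x \<in> C" for x
    using adj[of x y] neighbours_clique[OF that] y that C_subset by (cases "x = y") auto
  have "f x = f y" if "x \<in> pverts G" for x
  proof (cases "x \<in> C")
    case False
    then have "neighbours G x \<inter> C \<noteq> {}"
      using nexus[of x] nexus_pos that by auto
    then show ?thesis
      using adj[OF that] const_C by fastforce
  qed (use const_C in auto)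
  then show thesis
    using that by blast
qed

section \<open>An eigenvalue other than \<open>k\<close> and \<open>theta\<close>\<close>

text \<open>The roles of \<open>t\<close> and \<open>u\<close> are asymmetric: \<open>A - u\<close>
  is a factor of \<open>Q\<close>, while the columns of \<open>Q\<close> are killed by
  \<open>A - t\<close>. Exchanging them later gives the value of \<open>u\<close>.\<close>

lemma eigenvalue_times_clique_size:
  assumes ann: "\<And>f x. x \<in> pverts G \<Longrightarrow>
      shift G (real k) (shift G t (shift G theta (shift G u f))) x = 0"
    and t: "eigenvalue_on t" "t \<noteq> real k" "t \<noteq> theta" "t \<noteq> u"
  shows "t * (s - 1) = - real k"
proof -
  define B where "B f = shift G theta (shift G u f)" for f
  \<comment> \<open>The value of \<open>B\<close> on the constant 1, divided by the number of
    vertices, so that every column of \<open>Q\<close> sums to zero (\<open>sum_q\<close>).\<close>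
  define d where "d = (real k - theta) * (real k - u) / n"
  define \<delta> where "\<delta> y = (\<lambda>x. of_bool (x = y) :: real)" for y :: 'a
  \<comment> \<open>\<open>q y\<close> is the column of \<open>Q\<close> at \<open>y\<close>\<close>
  define q where "q y x = B (\<delta> y) x - d" for y x
  \<comment> \<open>Diagonal and edge entries of \<open>Q\<close>: there \<open>A\<^sup>2\<close>
    has entries \<open>k\<close> and \<open>l\<close>, and \<open>A\<close> has entries 0 and
    1.\<close>
  define q0 where "q0 = real k + theta * u - d"
  define q1 where "q1 = real l - theta - u - d"
  have sum_\<delta>: "(\<Sum>x\<in>A. g x * \<delta> y x) = (if y \<in> A then g y else 0)" if "finite A" for A y and g :: "'a \<Rightarrow> real"
    using that by (simp add: \<delta>_def)
  have shift_\<delta>: "shift G v (\<delta> y) x = of_bool (x \<in> neighbours G y) - v * \<delta> y x" for v x y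
    using sum_\<delta>[of "neighbours G x" "\<lambda>_. 1" y] neighbours_sym[of x y] by (simp add: shift_def)
  \<comment> \<open>Expands \<open>B\<close> as
    \<open>A\<^sup>2 - (theta + u) A + theta u I\<close>; the entries of \<open>A\<^sup>2\<close>
    count common neighbours.\<close>
  have B_\<delta>: "B (\<delta> y) x = real (card (neighbours G x \<inter> neighbours G y))
      - (theta + u) * of_bool (x \<in> neighbours G y) + theta * u * \<delta> y x" for x y
  proof -
    have "B (\<delta> y) x = (\<Sum>z\<in>neighbours G x. of_bool (z \<in> neighbours G y) - u * \<delta> y z)
        - theta * (of_bool (x \<in> neighbours G y) - u * \<delta> y x)"
      unfolding B_def shift_\<delta>[abs_def] by (subst shift_def) (simp add: shift_\<delta>)
    also have "(\<Sum>z\<in>neighbours G x. of_bool (z \<in> neighbours G y) - u * \<delta> y z) =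
        real (card (neighbours G x \<inter> neighbours G y)) - u * of_bool (x \<in> neighbours G y)"
      using sum_\<delta>[of "neighbours G x" "\<lambda>_. u" y] neighbours_sym[of x y]
      by (simp add: sum_subtractf Int_def)
    finally show ?thesis
      by (simp add: algebra_simps)
  qed
  have q_adj: "q y x = q1" if "x \<in> neighbours G y" for x y
    unfolding q_def B_\<delta> q1_def using that edge_regular[of x y] not_neighbour_self[of y]
    by (auto simp: \<delta>_def Int_commute)
  have q_self: "q y y = q0" if "y \<in> pverts G" for y
    unfolding q_def B_\<delta> q0_def using that regular by (simp add: \<delta>_def)
  have self_adjoint_B: "(\<Sum>x\<in>pverts G. g x * B f x) = (\<Sum>x\<in>pverts G. B g x * f x)" for f g
    unfolding B_def by (simp add: shift_self_adjoint shift_commute[of G u])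
  have sum_q: "(\<Sum>x\<in>pverts G. q y x) = 0" if "y \<in> pverts G" for y
  proof -
    have "(\<Sum>x\<in>pverts G. B (\<delta> y) x) = (real k - theta) * (real k - u)"
      using that sum_\<delta>[of "pverts G" "\<lambda>_. 1" y] by (simp add: B_def sum_shift)
    then show ?thesis
      using that by (auto simp: q_def sum_subtractf d_def)
  qed
  \<comment> \<open>By \<open>ann\<close>, \<open>A - k\<close> kills \<open>(A - t) q y\<close>,
    which is therefore constant; its sum is a multiple of the sum of \<open>q y\<close>, which is
    zero.\<close>
  have eig: "shift G t (q y) x = 0" if y: "y \<in> pverts G" and x: "x \<in> pverts G" for x y
  proof -
    have split: "shift G t (q y) x = shift G t (B (\<delta> y)) x - (real k - t) * d" if "x \<in> pverts G" for x
    proof -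
      have "shift G t (q y) x = shift G t (B (\<delta> y)) x - shift G t (\<lambda>_. d) x"
        by (simp add: q_def[abs_def] shift_def sum_subtractf algebra_simps)
      then show ?thesis using that by (simp add: shift_const)
    qed
    have "shift G (real k) (shift G t (q y)) x = 0" if "x \<in> pverts G" for x
    proof -
      have "shift G (real k) (shift G t (q y)) x =
          shift G (real k) (\<lambda>x. shift G t (B (\<delta> y)) x - (real k - t) * d) x"
        by (intro shift_cong split that)
      also have "\<dots> = shift G (real k) (shift G t (B (\<delta> y))) x - shift G (real k) (\<lambda>_. (real k - t) * d) x"
        by (simp add: shift_def sum_subtractf algebra_simps)
      finally show ?thesis
        using ann[OF that, of "\<delta> y"] that by (simp add: B_def shift_const)
    qed
    then obtain c where c: "\<And>x. x \<in> pverts G \<Longrightarrow> shift G t (q y) x = c"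
      using shift_k_eq_0_imp_const by blast
    have "n * c = 0"
      using sum_shift[of t "q y"] sum_q[OF y] c by simp
    then show ?thesis
      using c x by auto
  qed
  obtain y where y: "y \<in> C" "y \<in> pverts G"
    using C_nonempty C_subset by blast
  have diag: "real k * q1 = t * q0"
  proof -
    have "(\<Sum>x\<in>neighbours G y. q y x) = (\<Sum>x\<in>neighbours G y. q1)"
      by (intro sum.cong refl q_adj)
    then show ?thesis
      using eig[OF y(2) y(2)] y by (simp add: shift_def q_self regular)
  qed
  have clique_sum: "q0 + (s - 1) * q1 = 0"
  proof -
    have "(\<Sum>x\<in>C. q y x) = q0 + (\<Sum>x\<in>C - {y}. q y x)"
      using y by (simp add: sum.remove q_self)
    also have "(\<Sum>x\<in>C - {y}. q y x) = (\<Sum>x\<in>C - {y}. q1)"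
      using neighbours_clique[OF y(1)] by (intro sum.cong refl q_adj) auto
    also have "\<dots> = (s - 1) * q1"
      unfolding sum_constant card_clique_Diff[OF y(1)] by simp
    finally have "q0 + (s - 1) * q1 = (\<Sum>x\<in>C. q y x)"
      by simp
    \<comment> \<open>Second evaluation of the column sum over \<open>C\<close>: moving
      \<open>A - theta\<close> onto the indicator of \<open>C\<close> turns it into the constant
      \<open>e\<close>, and by \<open>theta_eq\<close> the term \<open>d * s\<close> cancels the
      result.\<close>
    also have "\<dots> = (\<Sum>x\<in>C. B (\<delta> y) x) - d * s"
      by (simp add: q_def sum_subtractf)
    also have "(\<Sum>x\<in>C. B (\<delta> y) x) = (\<Sum>x\<in>pverts G. indicator C x * B (\<delta> y) x)"
      using C_subset by (intro sum.mono_neutral_cong_left) auto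
    also have "\<dots> = (\<Sum>x\<in>pverts G. shift G theta (indicator C) x * shift G u (\<delta> y) x)"
      by (simp add: B_def shift_self_adjoint)
    also have "\<dots> = real e * (real k - u)"
      using y sum_\<delta>[of "pverts G" "\<lambda>_. 1" y]
      by (simp add: shift_clique sum_distrib_left[symmetric] sum_shift)
    also have "d * s = ((real k - theta) * s) * (real k - u) / n"
      by (simp add: d_def)
    also have "\<dots> = real e * (real k - u)"
      unfolding theta_eq using y by auto
    finally show ?thesis
      by simp
  qed
  have "q1 \<noteq> 0"
  proof
    assume "q1 = 0"
    then have "q0 = 0"
      using clique_sum by simp
    have B_eigen: "B f z = (t - theta) * (t - u) * f z"
      if f: "\<And>x. x \<in> pverts G \<Longrightarrow> shift G t f x = 0" and "z \<in> pverts G" for f z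
    proof -
      have scale: "shift G v f x = (t - v) * f x" if "x \<in> pverts G" for v x
        using f[OF that] by (simp add: shift_def algebra_simps)
      have "B f z = shift G theta (\<lambda>x. (t - u) * f x) z"
        unfolding B_def by (intro shift_cong scale that)
      also have "\<dots> = (t - u) * shift G theta f z"
        by (simp add: shift_def sum_distrib_left algebra_simps)
      finally show ?thesis
        using scale[OF that(2)] by simp
    qed
    \<comment> \<open>The trace argument, one column at a time: as \<open>q y\<close> sums to zero,
      its squared norm is \<open>B (q y) y\<close>, a multiple of the diagonal entry
      \<open>q0\<close>.\<close>
    have q_0: "q y x = 0" if y: "y \<in> pverts G" and x: "x \<in> pverts G" for x y
    proof -
      have "(\<Sum>x\<in>pverts G. (q y x)\<^sup>2) = (\<Sum>x\<in>pverts G. q y x * B (\<delta> y) x) - d * (\<Sum>x\<in>pverts G. q y x)"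
        unfolding sum_distrib_left sum_subtractf[symmetric]
        by (intro sum.cong refl) (simp add: q_def power2_eq_square algebra_simps)
      also have "(\<Sum>x\<in>pverts G. q y x * B (\<delta> y) x) = B (q y) y"
        using sum_\<delta>[of "pverts G" "B (q y)" y] y by (simp add: self_adjoint_B)
      also have "\<dots> = 0"
        using B_eigen[of "q y" y] eig y q_self \<open>q0 = 0\<close> by simp
      finally have "(\<Sum>x\<in>pverts G. (q y x)\<^sup>2) = 0"
        using sum_q[OF y] by simp
      then show ?thesis
        using x by (subst (asm) sum_nonneg_eq_0_iff) auto
    qed
    \<comment> \<open>The contradiction: \<open>Q = 0\<close> makes \<open>B\<close> equal to
      \<open>d J\<close>, which kills \<open>f\<close> because \<open>f\<close> sums to zero,
      whereas \<open>B\<close> scales \<open>f\<close> by the nonzero factor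
      \<open>(t - theta) * (t - u)\<close>.\<close>
    obtain f where ex: "\<exists>x\<in>pverts G. f x \<noteq> 0" and f: "\<And>x. x \<in> pverts G \<Longrightarrow> shift G t f x = 0"
      using t(1) by (auto simp: eigenvalue_on_def)
    from ex obtain z where z: "z \<in> pverts G" "f z \<noteq> 0"
      by blast
    have "(\<Sum>x\<in>pverts G. f x) = 0"
      using sum_shift[of t f] f t(2) by simp
    moreover have "B f z = (\<Sum>x\<in>pverts G. f x * B (\<delta> z) x)"
      using sum_\<delta>[of "pverts G" "B f" z] z(1) by (simp add: self_adjoint_B)
    moreover have "\<dots> = (\<Sum>x\<in>pverts G. f x * d)"
      using q_0[OF z(1)] by (intro sum.cong refl) (simp add: q_def)
    ultimately have "B f z = 0"
      by (simp add: sum_distrib_right[symmetric])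
    then show False
      using B_eigen[OF f z(1)] z(2) t by simp
  qed
  moreover have "q1 * (t * (s - 1) + real k) = t * (q0 + (s - 1) * q1)"
    using diag by (simp add: algebra_simps)
  ultimately have "t * (s - 1) + real k = 0"
    by (simp add: clique_sum)
  then show ?thesis
    by simp
qed

lemma card_eigenvalues_neq_4: "card {t :: complex. eigenvalue_on t} \<noteq> 4"
proof
  assume card4: "card {t :: complex. eigenvalue_on t} = 4"
  \<comment> \<open>The key lemma is stated over the reals, so the complex eigenvalues are first
    replaced by real ones.\<close>
  define R where "R = {t :: real. eigenvalue_on t}"
  have R: "{t :: complex. eigenvalue_on t} = of_real ` R"
    using eigenvalue_on_real by (force simp: R_def eigenvalue_on_of_real elim!: Reals_cases)
  then have "card R = 4"
    using card4 by (simp add: card_image inj_on_def)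
  moreover have mem: "real k \<in> R" "theta \<in> R"
    using eigenvalue_on_k eigenvalue_on_theta by (auto simp: R_def)
  ultimately have "card (R - {real k, theta}) = 2"
    using theta_neq by (subst card_Diff_subset) auto
  then obtain t u where tu: "R - {real k, theta} = {t, u}" "t \<noteq> u"
    by (auto simp: card_2_iff)
  then have R_eq: "R = {real k, theta, t, u}" and distinct:
      "t \<noteq> real k" "t \<noteq> theta" "u \<noteq> real k" "u \<noteq> theta" "eigenvalue_on t" "eigenvalue_on u"
    using mem by (auto simp: R_def)
  \<comment> \<open>Any ordering of the four eigenvalues is allowed, which serves both applications
    below.\<close>
  have ann: "foldr (shift G) ts f x = 0" if "set ts = R" "x \<in> pverts G" for ts f x
    using that R by (intro foldr_shift_eq_0) auto
  have "t * (s - 1) = - real k"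
    using ann[of "[real k, t, theta, u]"] R_eq tu(2) distinct
    by (intro eigenvalue_times_clique_size[of t u]) (auto simp: insert_commute)
  moreover have "u * (s - 1) = - real k"
    using ann[of "[real k, u, theta, t]"] R_eq tu(2) distinct
    by (intro eigenvalue_times_clique_size[of u t]) (auto simp: insert_commute)
  \<comment> \<open>Positivity of \<open>k\<close> excludes \<open>s = 1\<close>, so the two
    equations force \<open>t = u\<close>.\<close>
  ultimately show False
    using tu(2) k_pos by (metis mult_cancel_right mult_zero_right neg_equal_0_iff_equal of_nat_0_less_iff less_irrefl)
qed

end

section \<open>From the definitions to the fixed parameters, and the spectrum\<close>

lemma neumaier_graph_imp_neumaier:
  assumes "neumaier_graph G"
  obtains C k l e where "neumaier G C k l e"
proof -
  from assms have er: "Defs.edge_regular G" and nc: "\<not> complete_graph G"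
    by (auto simp: neumaier_graph_def)
  from er obtain k l where pg: "pair_graph G"
    and k: "\<And>x. x \<in> pverts G \<Longrightarrow> out_degree (with_proj G) x = k"
    and l: "\<And>x y. (x, y) \<in> parcs G \<Longrightarrow> card (neighbours G x \<inter> neighbours G y) = l"
    by (fastforce simp: edge_regular_def regular_graph_def)
  from assms obtain C e where C: "clique G C" and e: "e > 0"
    "\<And>x. x \<in> pverts G - C \<Longrightarrow> card (neighbours G x \<inter> C) = e"
    by (auto simp: neumaier_graph_def regular_clique_def)
  interpret pair_graph G by fact
  \<comment> \<open>A clique containing all vertices would make the graph complete.\<close>
  have "\<exists>x. x \<in> pverts G - C"
  proof (rule ccontr)
    assume "\<not> ?thesis"
    then have "pverts G = C"
      using C by (auto simp: clique_def)
    then have "parcs G = {(u, v). (u, v) \<in> pverts G \<times> pverts G \<and> u \<noteq> v}"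
      using C not_neighbour_self by (auto simp: clique_def neighbours_def dest: in_arcsD1 in_arcsD2)
    then show False
      using nc by (simp add: complete_graph_def complete_digraph_pair_def)
  qed
  then have "neumaier G C k l e"
    using C e k l by unfold_locales (auto simp: out_degree_eq_card_neighbours neighbours_def)
  then show thesis
    using that by blast
qed

theorem theorem3p1:
  fixes G :: "'a pair_pre_digraph" and vs :: "'a list"
  assumes "neumaier_graph G"
    and "distinct vs" and "set vs = pverts G"
  shows "card (spectrum (adjacency_matrix G vs :: complex mat)) \<noteq> 4"
proof -
  obtain C k l e where "neumaier G C k l e"
    using neumaier_graph_imp_neumaier[OF assms(1)] .
  then interpret neumaier G C k l e .
  have "spectrum (adjacency_matrix G vs :: complex mat) = {t. eigenvalue_on t}"
    using eigenvalue_adjacency_matrix[OF assms(2,3)] by (auto simp: spectrum_def)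
  then show ?thesis
    using card_eigenvalues_neq_4 by simp
qed

end
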